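(* Let $\{\mathbb P_n\}_{n\ge0}$, $\mathbb P_n=(P_{n,0},P_{n,1},\dots,P_{n,n})^t$, be the orthogonal polynomial system with $$P_{n,m}(x,y)=p^{(m)}_{n-m}(x)\,\rho(x)^m\,q_m\!\left(\frac{y}{\rho(x)}\right),\qquad 0\le m\le n,$$ constructed from $u_x,v_y,\rho$ as in the context. Then, for $n\ge0$, the matrix coefficients in the first three term relation $$x\,\mathbb P_n=A_{n,1}\mathbb P_{n+1}+B_{n,1}\mathbb P_n+C_{n,1}\mathbb P_{n-1}\qquad(\mathbb P_{-1}=0)$$ are as follows, with rows and columns indexed from $0$: - $A_{n,1}$ is the $(n+1)\times(n+2)$ matrix with entries $(A_{n,1})_{m,m}=a^{(m)}_{n-m}$ for $0\le m\le n$ and all other entries zero (in particular its last column is zero); - $B_{n,1}$ is the $(n+1)\times(n+1)$ diagonal matrix $\operatorname{diag}(b^{(0)}_n,b^{(1)}_{n-1},\dots,b^{(n)}_0)$; - $C_{n,1}$ (for $n\ge1$) is the $(n+1)\times n$ matrix with entries $(C_{n,1})_{m,m}=c^{(m)}_{n-m}$ for $0\le m\le n-1$ and all other entries zero (in particular its last row is zero). Here, writing $p^{(m)}_n(x)=k^{(m)}_nx^n+l^{(m)}_nx^{n-1}+\text{(lower degree terms)}$ and $h^{(m)}_n=\langle \rho(x)^{2m+1}u_x,(p^{(m)}_n)^2\rangle$, $$a^{(m)}_n=\frac{k^{(m)}_n}{k^{(m)}_{n+1}},\qquad b^{(m)}_n=\frac{l^{(m)}_n}{k^{(m)}_n}-\frac{l^{(m)}_{n+1}}{k^{(m)}_{n+1}}\qquad(n\ge0),\qquad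 c^{(m)}_n=a^{(m)}_{n-1}\frac{h^{(m)}_n}{h^{(m)}_{n-1}}\qquad(n\ge1),$$ with $l^{(m)}_0=0$.
   Context: $\Pi$ is the space of real univariate polynomials. A (univariate) moment functional is a real linear functional on $\Pi$. An orthogonal polynomial sequence for a moment functional $u$ is a sequence $\{p_n\}_{n\ge0}\subset\Pi$ with $\deg p_n=n$ and $\langle u,p_np_m\rangle=h_n\delta_{n,m}$, $h_n\ne0$ for all $n$; $u$ is quasi-definite if such a sequence exists, and a quasi-definite $u$ is symmetric if $\langle u,x^{2n+1}\rangle=0$ for all $n\ge0$. Left multiplication is $\langle q\,u,p\rangle=\langle u,qp\rangle$. **Construction.** $u_x$, $v_y$ are quasi-definite moment functionals acting on the variables $x$, $y$, and $\rho(x)$ satisfies one of: - Case I: $\rho(x)=r_1x+r_0$ with $r_0,r_1\in\mathbb R$, $|r_1|+|r_0|>0$. - Case II: $\rho(x)$ is the square root of a nonzero real polynomial of degree at most $2$, and $v_y$ is symmetric. It is assumed that $u^{(m)}_x=\rho(x)^{2m+1}u_x$ is a quasi-definite moment functional for every $m\ge0$. In Case II, $u_x$ is understood to be a linear functional on $\Pi+\rho\,\Pi$, so that $\langle\rho^ju_x,p\rangle=\langle u_x,\rho^jp\rangle$ makes sense for $j\ge0$. For each $m\ge0$, $\{p^{(m)}_n\}_{n\ge0}$ is an orthogonal polynomial sequence for $u^{(m)}_x$, and $\{q_n\}_{n\ge0}$ is an orthogonal polynomial sequence for $v_y$. Then $P_{n,m}$ is a polynomial in $(x,y)$ of total degree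 $n$ (in Case II because $q_m$ has the parity of $m$): if $q_m(t)=\sum_jc_jt^j$, then $\rho^mq_m(y/\rho)=\sum_jc_j\rho^{m-j}y^j$. The entries of $\mathbb P_0,\dots,\mathbb P_n$ form a basis of the real polynomials in $x,y$ of total degree at most $n$, and they are mutually orthogonal with respect to the bivariate functional $w$ given by $\langle w,x^hy^k\rangle=\langle\rho(x)^{k+1}u_x,x^h\rangle\langle v_y,y^k\rangle$. For any orthogonal polynomial system, $x\,\mathbb P_n$ has a unique expansion $x\,\mathbb P_n=A_{n,1}\mathbb P_{n+1}+B_{n,1}\mathbb P_n+C_{n,1}\mathbb P_{n-1}$ with real matrices $A_{n,1}$ of size $(n+1)\times(n+2)$, $B_{n,1}$ of size $(n+1)\times(n+1)$ and $C_{n,1}$ of size $(n+1)\times n$. *)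

theory Defs
  imports
    "HOL-Computational_Algebra.Computational_Algebra"
    "Jordan_Normal_Form.Matrix"
begin

section \<open>Univariate moment functionals\<close>

definition moment_functional :: "(real poly \<Rightarrow> real) \<Rightarrow> bool" where
  "moment_functional u \<longleftrightarrow>
     (\<forall>f g. u (f + g) = u f + u g) \<and> (\<forall>c f. u (Polynomial.smult c f) = c * u f)"

definition ortho_poly_seq :: "(real poly \<Rightarrow> real) \<Rightarrow> (nat \<Rightarrow> real poly) \<Rightarrow> bool" where
  "ortho_poly_seq u p \<longleftrightarrow>
     (\<forall>n. degree (p n) = n) \<and>
     (\<exists>h. (\<forall>n. h n \<noteq> 0) \<and> (\<forall>n m. u (p n * p m) = (if n = m then h n else 0)))"

definition quasi_definite :: "(real poly \<Rightarrow> real) \<Rightarrow> bool" where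
  "quasi_definite u \<longleftrightarrow> moment_functional u \<and> (\<exists>p. ortho_poly_seq u p)"

definition symmetric_functional :: "(real poly \<Rightarrow> real) \<Rightarrow> bool" where
  "symmetric_functional u \<longleftrightarrow>
     quasi_definite u \<and> (\<forall>n. u (Polynomial.monom 1 (2 * n + 1)) = 0)"


section \<open>The function \<open>\<rho>\<close> and functionals on \<open>\<Pi> + \<rho> \<Pi>\<close>\<close>

text \<open>
  The function \<open>\<rho>\<close> has type \<^typ>\<open>real \<Rightarrow> complex\<close>, because the polynomial under the square root
  in the second case may take negative values; any pointwise choice of the square root is
  admitted.  Only real polynomials and real scalars are used, so \<open>\<Pi> + \<rho> \<Pi>\<close> is a
  real vector space of functions.  In the first case \<open>\<rho>\<close> is a polynomial function and this
  space is just \<open>\<Pi>\<close>, with polynomials identified with the functions they induce.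
\<close>

definition rho_linear :: "(real \<Rightarrow> complex) \<Rightarrow> bool" where
  "rho_linear \<rho> \<longleftrightarrow>
     (\<exists>r0 r1 :: real. \<bar>r1\<bar> + \<bar>r0\<bar> > 0 \<and> (\<forall>x. \<rho> x = of_real (r1 * x + r0)))"

definition rho_sqrt :: "(real \<Rightarrow> complex) \<Rightarrow> bool" where
  "rho_sqrt \<rho> \<longleftrightarrow>
     (\<exists>d :: real poly. d \<noteq> 0 \<and> degree d \<le> 2 \<and> (\<forall>x. \<rho> x ^ 2 = of_real (poly d x)))"

definition poly_rho_space :: "(real \<Rightarrow> complex) \<Rightarrow> (real \<Rightarrow> complex) set" where
  "poly_rho_space \<rho> =
     {(\<lambda>x. of_real (poly f x) + \<rho> x * of_real (poly g x)) | f g :: real poly. True}"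

definition linear_on_space ::
  "(real \<Rightarrow> complex) set \<Rightarrow> ((real \<Rightarrow> complex) \<Rightarrow> real) \<Rightarrow> bool" where
  "linear_on_space V u \<longleftrightarrow>
     (\<forall>f\<in>V. \<forall>g\<in>V. u (\<lambda>x. f x + g x) = u f + u g) \<and>
     (\<forall>c :: real. \<forall>f\<in>V. u (\<lambda>x. of_real c * f x) = c * u f)"

text \<open>The functional \<open>\<rho>\<^sup>j u\<close> on \<open>\<Pi>\<close>; for \<open>j = 0\<close> it is the restriction of \<open>u\<close> to \<open>\<Pi>\<close>.
  In both cases \<open>\<rho>\<^sup>j f\<close> lies in \<open>\<Pi> + \<rho> \<Pi>\<close>.\<close>

definition rho_times ::
  "(real \<Rightarrow> complex) \<Rightarrow> nat \<Rightarrow> ((real \<Rightarrow> complex) \<Rightarrow> real) \<Rightarrow> real poly \<Rightarrow> real" where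
  "rho_times \<rho> j u f = u (\<lambda>x. \<rho> x ^ j * of_real (poly f x))"


section \<open>The bivariate polynomials\<close>

text \<open>Bivariate polynomials have type \<^typ>\<open>real poly poly\<close>: the outer variable is \<open>y\<close>, and the
  coefficients are polynomials in \<open>x\<close>.\<close>

definition eval2 :: "real poly poly \<Rightarrow> real \<Rightarrow> real \<Rightarrow> real" where
  "eval2 F x y = poly (poly F [:y:]) x"

text \<open>\<open>F(x,y) = g(x) \<rho>(x)\<^sup>m q(y / \<rho>(x))\<close>.  Since \<open>\<rho>\<close> vanishes at no more than two points, this
  determines \<open>F\<close>.\<close>

definition koornwinder_poly ::
  "(real \<Rightarrow> complex) \<Rightarrow> nat \<Rightarrow> real poly \<Rightarrow> real poly \<Rightarrow> real poly poly \<Rightarrow> bool" where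
  "koornwinder_poly \<rho> m g q F \<longleftrightarrow>
     (\<forall>x y. \<rho> x \<noteq> 0 \<longrightarrow>
        complex_of_real (eval2 F x y) =
          of_real (poly g x) * \<rho> x ^ m * poly (map_poly of_real q) (of_real y / \<rho> x))"


section \<open>The coefficients of the univariate three term relations\<close>

definition lead_term :: "(nat \<Rightarrow> real poly) \<Rightarrow> nat \<Rightarrow> real" where
  "lead_term p n = coeff (p n) n"

definition second_term :: "(nat \<Rightarrow> real poly) \<Rightarrow> nat \<Rightarrow> real" where
  "second_term p n = (if n = 0 then 0 else coeff (p n) (n - 1))"

definition ttr_a :: "(nat \<Rightarrow> real poly) \<Rightarrow> nat \<Rightarrow> real" where
  "ttr_a p n = lead_term p n / lead_term p (n + 1)"

definition ttr_b :: "(nat \<Rightarrow> real poly) \<Rightarrow> nat \<Rightarrow> real" where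
  "ttr_b p n = second_term p n / lead_term p n - second_term p (n + 1) / lead_term p (n + 1)"

text \<open>Only meaningful for \<open>n \<ge> 1\<close>.\<close>

definition ttr_c :: "(real poly \<Rightarrow> real) \<Rightarrow> (nat \<Rightarrow> real poly) \<Rightarrow> nat \<Rightarrow> real" where
  "ttr_c u p n = ttr_a p (n - 1) * (u (p n ^ 2) / u (p (n - 1) ^ 2))"


section \<open>Vectors of bivariate polynomials and the first three term relation\<close>

definition poly_vec :: "(nat \<Rightarrow> nat \<Rightarrow> real poly poly) \<Rightarrow> nat \<Rightarrow> real poly poly vec" where
  "poly_vec P n = vec (n + 1) (P n)"

text \<open>\<open>\<P>\<^bsub>n-1\<^esub>\<close>; for \<open>n = 0\<close> this is the vector with no entries, matching the \<open>1 \<times> 0\<close>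
  matrix in front of it.\<close>

definition prev_poly_vec :: "(nat \<Rightarrow> nat \<Rightarrow> real poly poly) \<Rightarrow> nat \<Rightarrow> real poly poly vec" where
  "prev_poly_vec P n = (if n = 0 then 0\<^sub>v 0 else poly_vec P (n - 1))"

definition const_mat :: "real mat \<Rightarrow> real poly poly mat" where
  "const_mat M = map_mat (\<lambda>c. [:[:c:]:]) M"

text \<open>\<open>[:[:0, 1:]:]\<close> is the bivariate polynomial \<open>x\<close>.\<close>

definition three_term_x ::
  "(nat \<Rightarrow> nat \<Rightarrow> real poly poly) \<Rightarrow> nat \<Rightarrow> real mat \<Rightarrow> real mat \<Rightarrow> real mat \<Rightarrow> bool" where
  "three_term_x P n A B C \<longleftrightarrow>
     [:[:0, 1:]:] \<cdot>\<^sub>v poly_vec P n =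
       const_mat A *\<^sub>v poly_vec P (n + 1) + const_mat B *\<^sub>v poly_vec P n
         + const_mat C *\<^sub>v prev_poly_vec P n"


section \<open>Existence and uniqueness of the bivariate polynomials\<close>

lemma moment_functional_sum:
  assumes "moment_functional u"
  shows "u (\<Sum>i\<in>S. f i) = (\<Sum>i\<in>S. u (f i))"
proof -
  have add: "u (f + g) = u f + u g" and sc: "u (Polynomial.smult c f) = c * u f" for f g c
    using assms by (auto simp: moment_functional_def)
  have z: "u 0 = 0" using sc[of 0 0] by simp
  show ?thesis by (induction S rule: infinite_finite_induct) (auto simp: add z)
qed

lemma ortho_poly_seq_nz:
  assumes "ortho_poly_seq u p"
  shows "degree (p n) = n" "coeff (p n) n \<noteq> 0"
proof -
  obtain h where d: "\<And>n. degree (p n) = n" and h: "\<And>n. h n \<noteq> 0"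
    and o: "\<And>n m. u (p n * p m) = (if n = m then h n else 0)"
    using assms unfolding ortho_poly_seq_def by blast
  show "degree (p n) = n" by (rule d)
  have "p n \<noteq> 0"
  proof
    assume "p n = 0"
    then have "u (p n * p (Suc n)) = u (p n * p n)" by simp
    then show False using o[of n n] o[of n "Suc n"] h[of n] by simp
  qed
  then show "coeff (p n) n \<noteq> 0" using d[of n] leading_coeff_0_iff[of "p n"] by simp
qed

lemma ortho_poly_seq_lower:
  assumes u: "moment_functional u" and p: "ortho_poly_seq u p"
  shows "degree f \<le> d \<Longrightarrow> d < n \<Longrightarrow> u (p n * f) = 0"
proof (induction d arbitrary: f rule: less_induct)
  case (less d)
  have add: "u (f + g) = u f + u g" and sc: "u (Polynomial.smult c f) = c * u f" for f g c
    using u by (auto simp: moment_functional_def)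
  have z: "u 0 = 0" using sc[of 0 0] by simp
  have orth: "u (p n * p d) = 0"
    using p less.prems unfolding ortho_poly_seq_def by auto
  define c where "c = coeff f d / coeff (p d) d"
  define g where "g = f - Polynomial.smult c (p d)"
  have f: "f = g + Polynomial.smult c (p d)" by (simp add: g_def)
  have "degree g \<le> d"
    using less.prems ortho_poly_seq_nz[OF p] unfolding g_def
    by (intro degree_diff_le) auto
  moreover have g0: "coeff g d = 0"
    using ortho_poly_seq_nz[OF p] by (simp add: g_def c_def)
  ultimately have "g = 0 \<or> degree g < d"
    using leading_coeff_0_iff[of g] by (cases "degree g = d") auto
  then have "u (p n * g) = 0"
  proof
    assume "g = 0" then show ?thesis by (simp add: z)
  next
    assume "degree g < d"
    then show ?thesis using less.IH[of "degree g" g] less.prems by simp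
  qed
  then show ?case by (simp add: f add sc orth ring_distribs)
qed

lemma symmetric_functional_reflect:
  assumes "symmetric_functional u"
  shows "u (pcompose f [:0, -1:]) = u f"
proof -
  have u: "moment_functional u" and odd: "\<And>n. u (Polynomial.monom 1 (2 * n + 1)) = 0"
    using assms by (auto simp: symmetric_functional_def quasi_definite_def)
  have sc: "u (Polynomial.smult c f) = c * u f" for f c
    using u by (auto simp: moment_functional_def)
  have X: "pcompose (Polynomial.monom c i) [:0, -1:] = Polynomial.smult (c * (-1) ^ i) (Polynomial.monom 1 i)"
    for c :: real and i
  proof (intro poly_ext)
    fix x :: real
    show "poly (pcompose (Polynomial.monom c i) [:0, -1:]) x =
        poly (Polynomial.smult (c * (-1) ^ i) (Polynomial.monom 1 i)) x"
      using power_minus[of x i] by (simp add: poly_pcompose Polynomial.poly_monom)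
  qed
  have eq: "(c * (-1) ^ i) * u (Polynomial.monom 1 i) = c * u (Polynomial.monom 1 i)" for c :: real and i
    using odd[of "i div 2"] by (cases "even i") auto
  have m: "u (Polynomial.monom c i) = c * u (Polynomial.monom 1 i)" for c i
    using sc[of c "Polynomial.monom 1 i"] by (simp add: Polynomial.smult_monom)
  define g where "g i = Polynomial.monom (coeff f i) i" for i
  have f: "(\<Sum>i\<le>degree f. g i) = f"
    unfolding g_def by (rule poly_as_sum_of_monoms)
  have g: "u (pcompose (g i) [:0, -1:]) = u (g i)" for i
    unfolding g_def by (simp only: X sc eq m[of "coeff f i" i])
  have "u (pcompose f [:0, -1:]) = u (\<Sum>i\<le>degree f. pcompose (g i) [:0, -1:])"
    by (simp only: f flip: pcompose_sum)
  also have "\<dots> = (\<Sum>i\<le>degree f. u (g i))"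
    by (simp only: moment_functional_sum[OF u] g)
  also have "\<dots> = u f"
    by (simp only: f flip: moment_functional_sum[OF u])
  finally show ?thesis .
qed

lemma symmetric_ortho_parity:
  assumes v: "symmetric_functional v" and q: "ortho_poly_seq v q"
    and j: "even j \<noteq> even m"
  shows "coeff (q m) j = 0"
proof -
  have mf: "moment_functional v"
    using v by (auto simp: symmetric_functional_def quasi_definite_def)
  have add: "v (f + g) = v f + v g" and sc: "v (Polynomial.smult c f) = c * v f" for f g c
    using mf by (auto simp: moment_functional_def)
  note nz = ortho_poly_seq_nz[OF q]
  define X where "X = [:0, -1 :: real:]"
  define s where "s = pcompose (q m) X + Polynomial.smult (- ((-1) ^ m)) (q m)"
  have coeff_s: "coeff s i = ((-1) ^ i - (-1) ^ m) * coeff (q m) i" for i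
    by (simp add: s_def X_def coeff_pcompose_linear algebra_simps)
  have "s = 0"
  proof (rule ccontr)
    assume "s \<noteq> 0"
    define d where "d = degree s"
    have d0: "coeff s d \<noteq> 0" using \<open>s \<noteq> 0\<close> by (simp add: d_def)
    then have "coeff (q m) d \<noteq> 0" and "d \<noteq> m" by (auto simp: coeff_s)
    then have dm: "d < m" using le_degree[of "q m" d] nz(1)[of m] by linarith
    have "v (pcompose (q m) X * q d) = v (pcompose (pcompose (q m) X * q d) X)"
      using symmetric_functional_reflect[OF v] by (simp add: X_def)
    also have "pcompose (pcompose (q m) X * q d) X = q m * pcompose (q d) X"
      by (intro poly_ext) (simp add: poly_pcompose X_def)
    also have "v \<dots> = 0"
      by (rule ortho_poly_seq_lower[OF mf q _ dm]) (simp add: X_def nz degree_pcompose)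
    finally have "v (pcompose (q m) X * q d) = 0" .
    moreover have "v (q m * q d) = 0"
      by (rule ortho_poly_seq_lower[OF mf q _ dm]) (simp add: nz)
    ultimately have s0: "v (s * q d) = 0"
      unfolding s_def by (simp only: ring_distribs add mult_smult_left sc)
    define c where "c = coeff s d / coeff (q d) d"
    define g where "g = s - Polynomial.smult c (q d)"
    have c0: "c \<noteq> 0" using d0 nz by (simp add: c_def)
    have "degree g \<le> d"
      unfolding g_def using nz by (intro degree_diff_le) (auto simp: d_def)
    moreover have "coeff g d = 0" using nz by (simp add: g_def c_def)
    ultimately have "g = 0 \<or> degree g < d"
      using leading_coeff_0_iff[of g] by (cases "degree g = d") auto
    then have g0: "v (q d * g) = 0"
      using ortho_poly_seq_lower[OF mf q order_refl, of g d] sc[of 0 0] by auto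
    have "s * q d = q d * g + Polynomial.smult c (q d * q d)"
      by (simp add: g_def algebra_simps)
    then have "v (s * q d) = c * v (q d * q d)" using g0 by (simp add: add sc)
    moreover have "v (q d * q d) \<noteq> 0"
      using q unfolding ortho_poly_seq_def by auto
    ultimately show False using s0 c0 by simp
  qed
  then have "((-1) ^ j - (-1) ^ m) * coeff (q m) j = 0"
    using coeff_s[of j] by simp
  then show ?thesis using j by (cases "even j") auto
qed

lemma rho_nonzero_infinite:
  assumes "rho_linear \<rho> \<or> rho_sqrt \<rho>"
  shows "infinite {x. \<rho> x \<noteq> 0}"
proof -
  obtain d :: "real poly" where d: "d \<noteq> 0" "\<And>x. \<rho> x = 0 \<Longrightarrow> poly d x = 0"
    using assms
  proof
    assume "rho_linear \<rho>"
    then obtain r0 r1 :: real where r: "\<bar>r1\<bar> + \<bar>r0\<bar> > 0" "\<And>x. \<rho> x = of_real (r1 * x + r0)"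
      unfolding rho_linear_def by blast
    have "poly [:r0, r1:] x = 0" if "\<rho> x = 0" for x
    proof -
      have "r1 * x + r0 = 0" using that by (simp only: r(2) of_real_eq_0_iff)
      then show ?thesis by (simp add: algebra_simps)
    qed
    moreover have "[:r0, r1:] \<noteq> 0" using r(1) by auto
    ultimately show ?thesis using that by blast
  next
    assume "rho_sqrt \<rho>"
    then obtain d :: "real poly" where "d \<noteq> 0" "\<And>x. \<rho> x ^ 2 = of_real (poly d x)"
      unfolding rho_sqrt_def by blast
    then show ?thesis
      using that[of d] by (metis of_real_eq_0_iff zero_eq_power2)
  qed
  have "finite {x. \<rho> x = 0}"
    by (rule finite_subset[OF _ poly_roots_finite[OF d(1)]]) (use d(2) in auto)
  moreover have "{x. \<rho> x \<noteq> 0} = - {x. \<rho> x = 0}" by auto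
  ultimately show ?thesis using infinite_UNIV_char_0 finite_compl by metis
qed

theorem koornwinder_poly_ex1:
  assumes rho: "rho_linear \<rho> \<or> (rho_sqrt \<rho> \<and> symmetric_functional v)"
    and q: "ortho_poly_seq v q"
  shows "\<exists>!F. koornwinder_poly \<rho> m g (q m) F"
proof (rule ex_ex1I)
  note nz = ortho_poly_seq_nz[OF q]
  have R: "\<exists>r. \<forall>x. complex_of_real (poly r x) = \<rho> x ^ k" if hyp: "rho_linear \<rho> \<or> even k" for k
    using rho
  proof (cases "rho_linear \<rho>")
    case True
    then obtain r0 r1 :: real where r: "\<And>x. \<rho> x = of_real (r1 * x + r0)"
      unfolding rho_linear_def by blast
    show ?thesis
      by (rule exI[of _ "[:r0, r1:] ^ k"]) (simp add: r algebra_simps)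
  next
    case False
    then obtain l where k: "k = 2 * l" using hyp by (auto elim: evenE)
    obtain d :: "real poly" where d: "\<And>x. \<rho> x ^ 2 = of_real (poly d x)"
      using rho False unfolding rho_sqrt_def by blast
    show ?thesis
      by (rule exI[of _ "d ^ l"]) (simp add: k power_mult d)
  qed
  define r where "r k = (SOME r. \<forall>x. complex_of_real (poly r x) = \<rho> x ^ k)" for k
  have r: "complex_of_real (poly (r k) x) = \<rho> x ^ k" if "rho_linear \<rho> \<or> even k" for k x
    using someI_ex[OF R[OF that]] unfolding r_def by blast
  define F where
    "F = (\<Sum>j\<le>m. Polynomial.monom (g * Polynomial.smult (coeff (q m) j) (r (m - j))) j)"
  have ev: "eval2 F x y = (\<Sum>j\<le>m. poly g x * coeff (q m) j * poly (r (m - j)) x * y ^ j)" for x y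
    by (simp add: eval2_def F_def poly_sum Polynomial.poly_monom algebra_simps)
  have "koornwinder_poly \<rho> m g (q m) F"
    unfolding koornwinder_poly_def
  proof (intro allI impI)
    fix x y assume x: "\<rho> x \<noteq> 0"
    let ?z = "of_real y / \<rho> x"
    have deg: "degree (map_poly complex_of_real (q m)) = m"
      using nz by (simp add: degree_map_poly)
    have summand: "complex_of_real (coeff (q m) j) * complex_of_real (poly (r (m - j)) x) * of_real y ^ j
        = \<rho> x ^ m * (of_real (coeff (q m) j) * ?z ^ j)" if "j \<le> m" for j
    proof (cases "coeff (q m) j = 0")
      case False
      have "rho_linear \<rho> \<or> even (m - j)"
        using rho symmetric_ortho_parity[OF _ q] False that by fastforce
      then have "complex_of_real (poly (r (m - j)) x) = \<rho> x ^ (m - j)" by (rule r)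
      then show ?thesis using x that by (simp add: power_divide power_diff)
    qed simp
    have "complex_of_real (eval2 F x y) = of_real (poly g x) *
        (\<Sum>j\<le>m. of_real (coeff (q m) j) * of_real (poly (r (m - j)) x) * of_real y ^ j)"
      by (simp add: ev sum_distrib_left mult.assoc)
    also have "\<dots> = of_real (poly g x) * (\<Sum>j\<le>m. \<rho> x ^ m * (of_real (coeff (q m) j) * ?z ^ j))"
      by (rule arg_cong[OF sum.cong[OF refl summand]]) simp
    also have "\<dots> = of_real (poly g x) * \<rho> x ^ m * poly (map_poly of_real (q m)) ?z"
      by (simp add: poly_altdef deg coeff_map_poly sum_distrib_left mult.assoc)
    finally show "complex_of_real (eval2 F x y) =
        of_real (poly g x) * \<rho> x ^ m * poly (map_poly of_real (q m)) ?z" .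
  qed
  then show "\<exists>F. koornwinder_poly \<rho> m g (q m) F" by blast
next
  fix F G assume F: "koornwinder_poly \<rho> m g (q m) F" and G: "koornwinder_poly \<rho> m g (q m) G"
  have inf: "infinite {x. \<rho> x \<noteq> 0}" using rho rho_nonzero_infinite by blast
  have z: "poly (F - G) [:y:] = 0" for y
  proof (rule ccontr)
    assume "poly (F - G) [:y:] \<noteq> 0"
    then have "finite {x. poly (poly (F - G) [:y:]) x = 0}" by (rule poly_roots_finite)
    moreover have "{x. \<rho> x \<noteq> 0} \<subseteq> {x. poly (poly (F - G) [:y:]) x = 0}"
    proof clarify
      fix x assume "\<rho> x \<noteq> 0"
      then have "complex_of_real (eval2 F x y) = complex_of_real (eval2 G x y)"
        using F G unfolding koornwinder_poly_def by metis
      then show "poly (poly (F - G) [:y:]) x = 0" by (simp add: eval2_def)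
    qed
    ultimately show False using inf finite_subset by blast
  qed
  have "F - G = 0"
  proof (rule ccontr)
    assume "F - G \<noteq> 0"
    then have "finite {t. poly (F - G) t = 0}" by (rule poly_roots_finite)
    moreover have "range (\<lambda>y. [:y:]) \<subseteq> {t. poly (F - G) t = 0}" using z by blast
    moreover have "infinite (range (\<lambda>y :: real. [:y:]))"
      using infinite_UNIV_char_0[where 'a = real] by (subst finite_image_iff) (auto simp: inj_on_def)
    ultimately show False using finite_subset by blast
  qed
  then show "F = G" by simp
qed

end

theory Submission
  imports Defs
begin

text \<open>
  The map \<open>g \<mapsto> g \<rho>\<^sup>m q\<^sub>m(y / \<rho>)\<close> is linear and commutes with multiplication by \<open>x\<close>, so the three
  term relation of \<open>{p\<^sup>(\<^sup>m\<^sup>)\<^sub>n}\<close> is carried over to \<open>x P\<^sub>n\<^sub>,\<^sub>m\<close> for each fixed \<open>m\<close>.  The coefficient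
  matrices are unique because \<open>P\<^sub>n\<^sub>,\<^sub>m\<close> has the leading monomial \<open>x\<^sup>n\<^sup>-\<^sup>m y\<^sup>m\<close> in the lexicographic order
  with \<open>y > x\<close>, and these monomials are pairwise distinct.
\<close>

section \<open>Univariate functionals and the three term relation for a fixed weight\<close>

lemma moment_functional_diff:
  assumes "moment_functional u"
  shows "u (f - g) = u f - u g"
proof -
  have "u (f - g + g) = u (f - g) + u g"
    using assms unfolding moment_functional_def by blast
  then show ?thesis by simp
qed

lemma moment_functional_smult:
  assumes "moment_functional u"
  shows "u (Polynomial.smult c f) = c * u f"
  using assms unfolding moment_functional_def by blast

lemma moment_functional_zero:
  assumes "moment_functional u"
  shows "u 0 = 0"
  using moment_functional_smult[OF assms, of 0 0] by simp

lemma degree_le_eliminate_leading: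
  fixes f :: "'a::zero poly"
  assumes "degree f \<le> n" and "coeff f n = 0"
  shows "f = 0 \<or> degree f < n"
  using assms leading_coeff_0_iff[of f] by (cases "degree f = n") auto

lemma ortho_poly_seq_norm_nz:
  assumes "ortho_poly_seq u p"
  shows "u (p n * p n) \<noteq> 0"
  using assms unfolding ortho_poly_seq_def by auto

text \<open>Subtracting the multiple of \<open>p n\<close> that cancels the coefficient of
  \<open>f\<close> at \<open>n\<close> leaves a polynomial of degree below \<open>n\<close> (or
  zero), which is orthogonal to \<open>p n\<close>.\<close>

lemma ortho_poly_seq_pairing:
  assumes u: "moment_functional u" and p: "ortho_poly_seq u p" and f: "degree f \<le> n"
  shows "u (p n * f) = coeff f n / lead_term p n * u (p n * p n)"
proof -
  note nz = ortho_poly_seq_nz[OF p]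
  define c where "c = coeff f n / lead_term p n"
  define g where "g = f - Polynomial.smult c (p n)"
  have "degree g \<le> n"
    unfolding g_def using f nz by (intro degree_diff_le) auto
  moreover have "coeff g n = 0"
    using nz by (simp add: g_def c_def lead_term_def)
  ultimately have "g = 0 \<or> degree g < n"
    by (rule degree_le_eliminate_leading)
  then have "u (p n * g) = 0"
    using ortho_poly_seq_lower[OF u p order_refl] moment_functional_zero[OF u] by auto
  moreover have "p n * g = p n * f - Polynomial.smult c (p n * p n)"
    by (simp add: g_def algebra_simps)
  ultimately show ?thesis
    by (simp add: moment_functional_diff[OF u] moment_functional_smult[OF u] c_def)
qed

text \<open>At \<open>j = degree f\<close> the pairing is the leading coefficient of
  \<open>f\<close> times a nonzero factor, so that coefficient vanishes.\<close>

lemma ortho_poly_seq_eq_0I: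
  assumes u: "moment_functional u" and p: "ortho_poly_seq u p"
    and orth: "\<And>j. j \<le> degree f \<Longrightarrow> u (p j * f) = 0"
  shows "f = 0"
proof -
  have "coeff f (degree f) / lead_term p (degree f) * u (p (degree f) * p (degree f)) = 0"
    using ortho_poly_seq_pairing[OF u p order_refl, of f] orth by simp
  then show ?thesis
    using ortho_poly_seq_norm_nz[OF p] ortho_poly_seq_nz(2)[OF p] by (simp add: lead_term_def)
qed

text \<open>Let \<open>f\<close> be the difference of the two sides. The values of
  \<open>ttr_a\<close> and \<open>ttr_b\<close> cancel its coefficients at \<open>n + 1\<close> and
  \<open>n\<close>, and \<open>ttr_c\<close> makes it orthogonal to every \<open>p j\<close> with
  \<open>j < n\<close>; a polynomial of degree below \<open>n\<close> with this property is
  zero.\<close>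

lemma ortho_poly_seq_three_term:
  assumes u: "moment_functional u" and p: "ortho_poly_seq u p"
  shows "[:0, 1:] * p n = Polynomial.smult (ttr_a p n) (p (n + 1)) + Polynomial.smult (ttr_b p n) (p n)
    + (if n = 0 then 0 else Polynomial.smult (ttr_c u p n) (p (n - 1)))"
proof -
  note nz = ortho_poly_seq_nz[OF p]
  note norm_nz = ortho_poly_seq_norm_nz[OF p]
  define r where "r = (if n = 0 then 0 else Polynomial.smult (ttr_c u p n) (p (n - 1)))"
  define f where "f = [:0, 1:] * p n - Polynomial.smult (ttr_a p n) (p (n + 1))
    - Polynomial.smult (ttr_b p n) (p n) - r"
  have r_deg: "coeff r i = 0" if "i \<ge> n" for i
    using that nz(1)[of "n - 1"] by (auto simp: r_def intro!: coeff_eq_0)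
  have deg_f: "degree f < n" if "f \<noteq> 0"
  proof -
    have high: "coeff f i = 0" if i: "i > n" for i
    proof (cases "i = n + 1")
      case True
      then show ?thesis
        using nz(2)[of "Suc n"] r_deg[of i] nz(1)[of n]
        by (simp add: f_def ttr_a_def lead_term_def coeff_pCons coeff_eq_0)
    next
      case False
      then obtain k where "i = Suc k" "k \<ge> n" using i by (cases i) auto
      then show ?thesis
        using False r_deg[of i] nz(1) by (simp add: f_def coeff_pCons coeff_eq_0)
    qed
    \<comment> \<open>For \<open>n = 0\<close> the convention \<open>second_term p 0 = 0\<close>
      matches the zero constant coefficient of \<open>[:0, 1:] * p 0\<close>.\<close>
    have "coeff f n = 0"
      using nz(2)[of n] nz(2)[of "Suc n"] r_deg[of n]
      by (cases n) (auto simp: f_def ttr_a_def ttr_b_def lead_term_def second_term_def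
          coeff_pCons field_simps)
    moreover have "degree f \<le> n" using high by (intro degree_le) auto
    ultimately show ?thesis using degree_le_eliminate_leading that by blast
  qed
  have orth: "u (p j * f) = 0" if j: "j < n" for j
  proof -
    have [simp]: "u (p j * p (Suc n)) = 0" "u (p j * p n) = 0"
      using p j unfolding ortho_poly_seq_def by auto
    \<comment> \<open>The factor \<open>x\<close> moves from \<open>p n\<close> to
      \<open>p j\<close>, and the terms with \<open>p (n + 1)\<close> and \<open>p n\<close> drop
      out by orthogonality.\<close>
    have split: "u (p j * f) = u (p n * ([:0, 1:] * p j)) - u (p j * r)"
    proof -
      have "p j * f = p n * ([:0, 1:] * p j) - Polynomial.smult (ttr_a p n) (p j * p (n + 1))
          - Polynomial.smult (ttr_b p n) (p j * p n) - p j * r"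
        by (simp add: f_def algebra_simps)
      then show ?thesis
        by (simp only: moment_functional_diff[OF u] moment_functional_smult[OF u]) simp
    qed
    have "degree ([:0, 1:] * p j) \<le> Suc j"
      using nz(1)[of j] degree_mult_le[of "[:0, 1:]" "p j"] by simp
    then have "u (p n * ([:0, 1:] * p j)) = coeff ([:0, 1:] * p j) n / lead_term p n * u (p n * p n)"
      using j by (intro ortho_poly_seq_pairing[OF u p]) simp
    \<comment> \<open>For \<open>j = n - 1\<close> the coefficient of \<open>x * p j\<close> at
      \<open>n\<close> is the leading coefficient of \<open>p j\<close>, and the quotient of norms
      in \<open>ttr_c\<close> balances the two sides. For smaller \<open>j\<close> both sides are
      zero.\<close>
    also have "\<dots> = u (p j * r)"
    proof (cases "n = Suc j")
      case True
      then show ?thesis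
        using norm_nz[of j]
        by (simp add: r_def moment_functional_smult[OF u] ttr_c_def ttr_a_def lead_term_def
            coeff_pCons power2_eq_square)
    next
      case False
      then have "coeff (p j) (n - 1) = 0" using j nz(1)[of j] by (intro coeff_eq_0) simp
      moreover have "u (p j * p (n - 1)) = 0"
        using p j False unfolding ortho_poly_seq_def by auto
      ultimately show ?thesis
        using j by (cases n) (auto simp: r_def moment_functional_smult[OF u] coeff_pCons)
    qed
    finally show ?thesis using split by simp
  qed
  \<comment> \<open>\<open>deg_f\<close> speaks of nonzero \<open>f\<close> because for
    \<open>n = 0\<close> the zero polynomial does not have degree below \<open>n\<close>.\<close>
  have "f = 0"
  proof (rule ccontr)
    assume "f \<noteq> 0"
    then have "f = 0"
      using deg_f orth by (intro ortho_poly_seq_eq_0I[OF u p]) auto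
    with \<open>f \<noteq> 0\<close> show False by contradiction
  qed
  then show ?thesis unfolding f_def r_def by (simp add: algebra_simps)
qed

section \<open>Carrying univariate identities over to bivariate polynomials\<close>

lemma koornwinder_poly_add:
  assumes "koornwinder_poly \<rho> m g q F" and "koornwinder_poly \<rho> m g' q F'"
  shows "koornwinder_poly \<rho> m (g + g') q (F + F')"
  using assms by (simp add: koornwinder_poly_def eval2_def algebra_simps)

text \<open>Factors in \<open>x\<close> alone pass through the construction: constant
  \<open>f\<close> gives scalars, and \<open>f = [:0, 1:]\<close> gives multiplication by
  \<open>x\<close>.\<close>

lemma koornwinder_poly_mult:
  assumes "koornwinder_poly \<rho> m g q F"
  shows "koornwinder_poly \<rho> m (f * g) q ([:f:] * F)"
  using assms by (simp add: koornwinder_poly_def eval2_def algebra_simps)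

text \<open>At a fixed \<open>x\<close> with \<open>\<rho> x \<noteq> 0\<close>, the coefficient of
  \<open>y^j\<close> is \<open>g(x) * \<rho>(x)^m / \<rho>(x)^j\<close> times the coefficient of
  \<open>q\<close> at \<open>j\<close>. For \<open>j = m\<close> the powers of \<open>\<rho>\<close>
  cancel, and for \<open>j > m\<close> the coefficient of \<open>q\<close> is zero. Infinitely many
  such \<open>x\<close> turn this into an identity of polynomials.\<close>

lemma koornwinder_poly_coeff_ge:
  assumes rho: "infinite {x. \<rho> x \<noteq> 0}" and F: "koornwinder_poly \<rho> m g q F"
    and deg: "degree q \<le> m" and j: "m \<le> j"
  shows "coeff F j = Polynomial.smult (coeff q j) g"
proof (rule ccontr)
  assume "coeff F j \<noteq> Polynomial.smult (coeff q j) g"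
  then have "finite {x. poly (coeff F j - Polynomial.smult (coeff q j) g) x = 0}"
    by (intro poly_roots_finite) simp
  moreover have "{x. \<rho> x \<noteq> 0} \<subseteq> {x. poly (coeff F j - Polynomial.smult (coeff q j) g) x = 0}"
  proof clarify
    fix x assume x: "\<rho> x \<noteq> 0"
    \<comment> \<open>\<open>L\<close> and \<open>R\<close> are the two sides at this
      \<open>x\<close> as complex polynomials in \<open>y\<close>. They agree at all real
      \<open>y\<close>, which suffices for equality of coefficients.\<close>
    define L where "L = map_poly (\<lambda>c. complex_of_real (poly c x)) F"
    define R where "R = Polynomial.smult (of_real (poly g x) * \<rho> x ^ m)
      (pcompose (map_poly of_real q) [:0, 1 / \<rho> x:])"
    have L: "poly L (of_real y) = of_real (eval2 F x y)" for y
    proof -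
      have "eval2 F x y = (\<Sum>i\<le>degree F. poly (coeff F i) x * y ^ i)"
        by (simp add: eval2_def poly_altdef[of F] poly_sum)
      \<comment> \<open>Evaluating the coefficients at \<open>x\<close> may lower the degree, so the
        sum for \<open>L\<close> is extended by zeros up to \<open>degree F\<close>.\<close>
      moreover have "poly L (of_real y) = (\<Sum>i\<le>degree F. coeff L i * of_real y ^ i)"
        using map_poly_degree_leq[of "\<lambda>c. complex_of_real (poly c x)" F]
        by (subst poly_altdef, intro sum.mono_neutral_left) (auto simp: L_def coeff_eq_0)
      ultimately show ?thesis by (simp add: L_def coeff_map_poly)
    qed
    have "L = R"
    proof (rule ccontr)
      assume "L \<noteq> R"
      then have "finite {z. poly (L - R) z = 0}" by (intro poly_roots_finite) simp
      moreover have "range complex_of_real \<subseteq> {z. poly (L - R) z = 0}"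
        using F x by (auto simp: L R_def koornwinder_poly_def poly_pcompose)
      moreover have "infinite (range complex_of_real)"
        using infinite_UNIV_char_0[where 'a = real] by (subst finite_image_iff) (auto simp: inj_on_def)
      ultimately show False using finite_subset by blast
    qed
    then have "complex_of_real (poly (coeff F j) x) =
        of_real (poly g x) * \<rho> x ^ m * ((1 / \<rho> x) ^ j * of_real (coeff q j))"
      using coeff_map_poly[of "\<lambda>c. complex_of_real (poly c x)" F j]
      by (simp add: L_def R_def coeff_pcompose_linear coeff_map_poly)
    also have "\<dots> = of_real (coeff q j * poly g x)"
      using x deg j coeff_eq_0[of q j] by (cases "j = m") (auto simp: field_simps)
    finally show "poly (coeff F j - Polynomial.smult (coeff q j) g) x = 0"
      by (simp only: of_real_eq_iff) simp
  qed
  ultimately show False using rho finite_subset by blast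
qed

section \<open>Linear independence and uniqueness of the coefficient matrices\<close>

text \<open>Otherwise, among the indices with nonzero \<open>\<alpha>\<close>, take the largest
  \<open>j0\<close> and then the largest \<open>k0\<close> for it. The leading monomial of
  \<open>F k0 j0\<close> cannot be cancelled by the other terms.\<close>

lemma triangular_independent:
  fixes F :: "nat \<Rightarrow> nat \<Rightarrow> real poly poly"
  assumes S: "finite S" "\<And>k j. (k, j) \<in> S \<Longrightarrow> j \<le> k"
    and high: "\<And>k j i. j \<le> k \<Longrightarrow> j < i \<Longrightarrow> coeff (F k j) i = 0"
    and deg: "\<And>k j. j \<le> k \<Longrightarrow> degree (coeff (F k j) j) = k - j"
    and nz: "\<And>k j. j \<le> k \<Longrightarrow> coeff (F k j) j \<noteq> 0"
    and zero: "(\<Sum>(k, j)\<in>S. [:[:\<alpha> k j:]:] * F k j) = 0"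
    and s: "(k, j) \<in> S"
  shows "\<alpha> k j = 0"
proof (rule ccontr)
  assume "\<alpha> k j \<noteq> 0"
  define T where "T = {(k, j) \<in> S. \<alpha> k j \<noteq> 0}"
  have T: "finite T" "T \<noteq> {}"
    using S(1) s \<open>\<alpha> k j \<noteq> 0\<close> by (auto simp: T_def intro: finite_subset[OF _ S(1)])
  define j0 where "j0 = Max (snd ` T)"
  define k0 where "k0 = Max (fst ` {t \<in> T. snd t = j0})"
  have "j0 \<in> snd ` T" unfolding j0_def using T by (intro Max_in) auto
  then have "k0 \<in> fst ` {t \<in> T. snd t = j0}"
    unfolding k0_def using T by (intro Max_in) auto
  then have k0: "(k0, j0) \<in> T" by force
  have jmax: "j \<le> j0" if "(k, j) \<in> T" for k j
    unfolding j0_def using that T by (intro Max_ge) force+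
  have kmax: "k \<le> k0" if "(k, j0) \<in> T" for k
    unfolding k0_def using that T by (intro Max_ge) force+
  have jk0: "j0 \<le> k0" "(k0, j0) \<in> S" "\<alpha> k0 j0 \<noteq> 0" using k0 S(2) by (auto simp: T_def)
  \<comment> \<open>\<open>c\<close> extracts the coefficient of \<open>x^(k0 - j0) * y^j0\<close>.
    A term with \<open>j < j0\<close> has degree below \<open>j0\<close> in \<open>y\<close>; one
    with \<open>j = j0\<close> and \<open>k < k0\<close> has too small a degree in \<open>x\<close>
    there.\<close>
  define c where "c G = coeff (coeff G j0) (k0 - j0)" for G :: "real poly poly"
  have c: "\<alpha> k j * c (F k j) = 0" if "(k, j) \<in> S - {(k0, j0)}" for k j
  proof (cases "\<alpha> k j = 0")
    case False
    then have t: "(k, j) \<in> T" and jk: "j \<le> k" using that S(2) by (auto simp: T_def)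
    show ?thesis
    proof (cases "j = j0")
      case True
      then have "k < k0" using kmax t that by (auto simp: order.strict_iff_order)
      then show ?thesis using True jk deg[OF jk] by (simp add: c_def coeff_eq_0)
    next
      case False
      then have "j < j0" using jmax[OF t] by simp
      then show ?thesis using high jk by (simp add: c_def)
    qed
  qed simp
  have "0 = c (\<Sum>(k, j)\<in>S. [:[:\<alpha> k j:]:] * F k j)"
    unfolding zero by (simp add: c_def)
  also have "\<dots> = (\<Sum>(k, j)\<in>S. \<alpha> k j * c (F k j))"
    by (simp add: c_def coeff_sum case_prod_beta)
  also have "\<dots> = \<alpha> k0 j0 * c (F k0 j0)"
    by (subst sum.remove[OF S(1) jk0(2)], subst sum.neutral) (use c in fast, simp)
  finally show False
    using jk0 deg[OF jk0(1)] nz[OF jk0(1)] leading_coeff_0_iff[of "coeff (F k0 j0) j0"]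
    by (simp add: c_def)
qed

text \<open>Reduces the matrix relation to one polynomial identity per row. At \<open>n = 0\<close>
  the truncated \<open>n - 1\<close> stands under an empty sum, in accordance with the empty vector
  \<open>prev_poly_vec P 0\<close>.\<close>

lemma three_term_x_iff:
  assumes A: "A \<in> carrier_mat (n + 1) (n + 2)"
    and B: "B \<in> carrier_mat (n + 1) (n + 1)"
    and C: "C \<in> carrier_mat (n + 1) n"
  shows "three_term_x P n A B C \<longleftrightarrow> (\<forall>i\<le>n. [:[:0, 1:]:] * P n i =
    (\<Sum>j<n+2. [:[:A $$ (i, j):]:] * P (n + 1) j) + (\<Sum>j<n+1. [:[:B $$ (i, j):]:] * P n j)
      + (\<Sum>j<n. [:[:C $$ (i, j):]:] * P (n - 1) j))"
proof -
  have row: "(const_mat M *\<^sub>v w) $ i = (\<Sum>j<d. [:[:M $$ (i, j):]:] * w $ j)"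
    if "M \<in> carrier_mat (n + 1) d" "dim_vec w = d" "i \<le> n" for M w d i
    using that by (auto simp: const_mat_def scalar_prod_def atLeast0LessThan intro!: sum.cong)
  have dims: "dim_vec (poly_vec P k) = k + 1" "dim_vec (prev_poly_vec P n) = n" for k
    by (auto simp: poly_vec_def prev_poly_vec_def)
  have entry: "j < n \<Longrightarrow> prev_poly_vec P n $ j = P (n - 1) j"
    "j < k + 1 \<Longrightarrow> poly_vec P k $ j = P k j" for j k
    by (auto simp: poly_vec_def prev_poly_vec_def)
  have "three_term_x P n A B C \<longleftrightarrow> (\<forall>i\<le>n. ([:[:0, 1:]:] \<cdot>\<^sub>v poly_vec P n) $ i =
      (const_mat A *\<^sub>v poly_vec P (n + 1)) $ i + (const_mat B *\<^sub>v poly_vec P n) $ i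
         + (const_mat C *\<^sub>v prev_poly_vec P n) $ i)"
    using assms by (auto simp: three_term_x_def vec_eq_iff dims const_mat_def less_Suc_eq_le)
  also have "\<dots> \<longleftrightarrow> (\<forall>i\<le>n. [:[:0, 1:]:] * P n i =
    (\<Sum>j<n+2. [:[:A $$ (i, j):]:] * P (n + 1) j) + (\<Sum>j<n+1. [:[:B $$ (i, j):]:] * P n j)
      + (\<Sum>j<n. [:[:C $$ (i, j):]:] * P (n - 1) j))"
  proof (intro all_cong)
    fix i assume i: "i \<le> n"
    have "(const_mat A *\<^sub>v poly_vec P (n + 1)) $ i = (\<Sum>j<n+2. [:[:A $$ (i, j):]:] * P (n + 1) j)"
      using row[OF A _ i, of "poly_vec P (n + 1)"] by (simp add: dims entry)
    moreover have "(const_mat B *\<^sub>v poly_vec P n) $ i = (\<Sum>j<n+1. [:[:B $$ (i, j):]:] * P n j)"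
      using row[OF B _ i, of "poly_vec P n"] by (simp add: dims entry)
    moreover have "(const_mat C *\<^sub>v prev_poly_vec P n) $ i = (\<Sum>j<n. [:[:C $$ (i, j):]:] * P (n - 1) j)"
      using row[OF C _ i, of "prev_poly_vec P n"] by (simp add: dims entry)
    ultimately show "([:[:0, 1:]:] \<cdot>\<^sub>v poly_vec P n) $ i =
      (const_mat A *\<^sub>v poly_vec P (n + 1)) $ i + (const_mat B *\<^sub>v poly_vec P n) $ i
         + (const_mat C *\<^sub>v prev_poly_vec P n) $ i \<longleftrightarrow> [:[:0, 1:]:] * P n i =
    (\<Sum>j<n+2. [:[:A $$ (i, j):]:] * P (n + 1) j) + (\<Sum>j<n+1. [:[:B $$ (i, j):]:] * P n j)
      + (\<Sum>j<n. [:[:C $$ (i, j):]:] * P (n - 1) j)"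
      using i by (simp add: dims entry)
  qed
  finally show ?thesis .
qed

text \<open>Subtracting two relations in each row gives a vanishing combination of the entries at
  levels \<open>n + 1\<close>, \<open>n\<close> and \<open>n - 1\<close>, to which
  \<open>triangular_independent\<close> applies.\<close>

lemma three_term_x_unique:
  assumes A: "A \<in> carrier_mat (n + 1) (n + 2)" "A' \<in> carrier_mat (n + 1) (n + 2)"
    and B: "B \<in> carrier_mat (n + 1) (n + 1)" "B' \<in> carrier_mat (n + 1) (n + 1)"
    and C: "C \<in> carrier_mat (n + 1) n" "C' \<in> carrier_mat (n + 1) n"
    and high: "\<And>k j i. j \<le> k \<Longrightarrow> j < i \<Longrightarrow> coeff (P k j) i = 0"
    and deg: "\<And>k j. j \<le> k \<Longrightarrow> degree (coeff (P k j) j) = k - j"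
    and nz: "\<And>k j. j \<le> k \<Longrightarrow> coeff (P k j) j \<noteq> 0"
    and ABC: "three_term_x P n A B C" and ABC': "three_term_x P n A' B' C'"
  shows "A = A' \<and> B = B' \<and> C = C'"
proof -
  have rows: "A $$ (i, j) = A' $$ (i, j)" "l \<le> n \<Longrightarrow> B $$ (i, l) = B' $$ (i, l)"
    "h < n \<Longrightarrow> C $$ (i, h) = C' $$ (i, h)"
    if i: "i \<le> n" and j: "j < n + 2" for i j l h
  proof -
    \<comment> \<open>The three rows of differences are merged into one family indexed by level and
      position; the last branch is meant for level \<open>n - 1\<close>.\<close>
    define \<alpha> where "\<alpha> k j = (if k = n + 1 then A $$ (i, j) - A' $$ (i, j)
      else if k = n then B $$ (i, j) - B' $$ (i, j) else C $$ (i, j) - C' $$ (i, j))" for k j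
    define S1 where "S1 = Pair (n + 1) ` {..<n+2}"
    define S2 where "S2 = Pair n ` {..<n+1}"
    define S3 where "S3 = Pair (n - 1) ` {..<n}"
    define S where "S = S1 \<union> S2 \<union> S3"
    let ?t = "\<lambda>(k, j). [:[:\<alpha> k j:]:] * P k j"
    have "sum ?t S = sum ?t S1 + sum ?t S2 + sum ?t S3"
      unfolding S_def
      by (subst sum.union_disjoint, force simp: S1_def S2_def, force simp: S3_def,
          force simp: S1_def S2_def S3_def)
        (subst sum.union_disjoint, auto simp: S1_def S2_def)
    also have "sum ?t S1 = (\<Sum>j<n+2. [:[:A $$ (i, j) - A' $$ (i, j):]:] * P (n + 1) j)"
      unfolding S1_def by (simp add: sum.reindex inj_on_def \<alpha>_def del: sum.lessThan_Suc)
    also have "sum ?t S2 = (\<Sum>j<n+1. [:[:B $$ (i, j) - B' $$ (i, j):]:] * P n j)"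
      unfolding S2_def by (simp add: sum.reindex inj_on_def \<alpha>_def del: sum.lessThan_Suc)
    \<comment> \<open>For \<open>n = 0\<close> truncation makes \<open>n - 1\<close> equal to
      \<open>n\<close>, where \<open>\<alpha>\<close> takes the branch of \<open>B\<close>;
      \<open>S3\<close> is empty then, hence the case split.\<close>
    also have "sum ?t S3 = (\<Sum>j<n. [:[:C $$ (i, j) - C' $$ (i, j):]:] * P (n - 1) j)"
      unfolding S3_def by (cases n) (simp_all add: sum.reindex inj_on_def \<alpha>_def del: sum.lessThan_Suc)
    also have "(\<Sum>j<n+2. [:[:A $$ (i, j) - A' $$ (i, j):]:] * P (n + 1) j)
        + (\<Sum>j<n+1. [:[:B $$ (i, j) - B' $$ (i, j):]:] * P n j)
        + (\<Sum>j<n. [:[:C $$ (i, j) - C' $$ (i, j):]:] * P (n - 1) j)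
        = [:[:0, 1:]:] * P n i - [:[:0, 1:]:] * P n i"
    proof -
      have d: "(\<Sum>j<N. [:[:a j - b j:]:] * G j)
          = (\<Sum>j<N. [:[:a j:]:] * G j) - (\<Sum>j<N. [:[:b j:]:] * G j)"
        for a b :: "nat \<Rightarrow> real" and G and N :: nat
      proof -
        have "[:[:a j - b j:]:] * G j = [:[:a j:]:] * G j - [:[:b j:]:] * G j" for j
          unfolding left_diff_distrib[symmetric] by simp
        then show ?thesis unfolding sum_subtractf[symmetric] by (rule sum.cong[OF refl])
      qed
      have x: "[:[:0, 1:]:] * P n i =
    (\<Sum>j<n+2. [:[:A $$ (i, j):]:] * P (n + 1) j) + (\<Sum>j<n+1. [:[:B $$ (i, j):]:] * P n j)
      + (\<Sum>j<n. [:[:C $$ (i, j):]:] * P (n - 1) j)"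
        "[:[:0, 1:]:] * P n i =
    (\<Sum>j<n+2. [:[:A' $$ (i, j):]:] * P (n + 1) j) + (\<Sum>j<n+1. [:[:B' $$ (i, j):]:] * P n j)
      + (\<Sum>j<n. [:[:C' $$ (i, j):]:] * P (n - 1) j)"
        by (rule three_term_x_iff[OF A(1) B(1) C(1), THEN iffD1, OF ABC, THEN spec, THEN mp, OF i],
            rule three_term_x_iff[OF A(2) B(2) C(2), THEN iffD1, OF ABC', THEN spec, THEN mp, OF i])
      show ?thesis unfolding d add_diff_add[symmetric] x[symmetric] by (rule refl)
    qed
    finally have zero: "sum ?t S = 0" by simp
    have \<alpha>: "\<alpha> k j = 0" if "(k, j) \<in> S" for k j
      by (rule triangular_independent[OF _ _ high deg nz zero that])
        (auto simp: S_def S1_def S2_def S3_def)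
    show "A $$ (i, j) = A' $$ (i, j)"
      using \<alpha>[of "n + 1" j] j by (simp add: \<alpha>_def S_def S1_def)
    show "B $$ (i, l) = B' $$ (i, l)" if "l \<le> n"
      using \<alpha>[of n l] that by (simp add: \<alpha>_def S_def S2_def)
    show "C $$ (i, h) = C' $$ (i, h)" if "h < n"
      using \<alpha>[of "n - 1" h] that by (cases n) (simp_all add: \<alpha>_def S_def S3_def)
  qed
  have "A = A'" by (rule eq_matI) (use A rows in auto)
  \<comment> \<open>Here and for \<open>C\<close>, the value \<open>0\<close> fills the column index
    of \<open>A\<close> shared by the facts \<open>rows\<close>.\<close>
  moreover have "B = B'" by (rule eq_matI) (use B rows(2)[of _ 0] in auto)
  moreover have "C = C'" by (rule eq_matI) (use C rows(3)[of _ 0] in auto)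
  ultimately show ?thesis by blast
qed

section \<open>The explicit coefficient matrices\<close>

text \<open>The equivalence expresses both that the listed matrices satisfy the relation and that
  they are the only ones of these sizes.\<close>

theorem theorem4p2:
  fixes u :: "(real \<Rightarrow> complex) \<Rightarrow> real" and v :: "real poly \<Rightarrow> real"
    and \<rho> :: "real \<Rightarrow> complex"
    and p :: "nat \<Rightarrow> nat \<Rightarrow> real poly" and q :: "nat \<Rightarrow> real poly"
    and P :: "nat \<Rightarrow> nat \<Rightarrow> real poly poly"
    and n :: nat and A B C :: "real mat"
  assumes rho: "rho_linear \<rho> \<or> (rho_sqrt \<rho> \<and> symmetric_functional v)"
    and u_lin: "linear_on_space (poly_rho_space \<rho>) u"
    and u_qd: "quasi_definite (rho_times \<rho> 0 u)"
    and v_qd: "quasi_definite v"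
    and um_qd: "\<And>m. quasi_definite (rho_times \<rho> (2 * m + 1) u)"
    and p_ops: "\<And>m. ortho_poly_seq (rho_times \<rho> (2 * m + 1) u) (p m)"
    and q_ops: "ortho_poly_seq v q"
    and P: "\<And>k m. m \<le> k \<Longrightarrow> koornwinder_poly \<rho> m (p m (k - m)) (q m) (P k m)"
    and A: "A \<in> carrier_mat (n + 1) (n + 2)"
    and B: "B \<in> carrier_mat (n + 1) (n + 1)"
    and C: "C \<in> carrier_mat (n + 1) n"
  shows "three_term_x P n A B C \<longleftrightarrow>
    A = mat (n + 1) (n + 2) (\<lambda>(i, j). if i = j then ttr_a (p i) (n - i) else 0) \<and>
    B = mat (n + 1) (n + 1) (\<lambda>(i, j). if i = j then ttr_b (p i) (n - i) else 0) \<and>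
    C = mat (n + 1) n
      (\<lambda>(i, j). if i = j then ttr_c (rho_times \<rho> (2 * i + 1) u) (p i) (n - i) else 0)"
proof -
  have um: "moment_functional (rho_times \<rho> (2 * m + 1) u)" for m
    using um_qd unfolding quasi_definite_def by blast
  have inf: "infinite {x. \<rho> x \<noteq> 0}" using rho rho_nonzero_infinite by blast
  note pnz = ortho_poly_seq_nz[OF p_ops] and qnz = ortho_poly_seq_nz[OF q_ops]
  \<comment> \<open>At \<open>i = j\<close> this gives the leading coefficient of
    \<open>P k j\<close> in \<open>y\<close> as a nonzero multiple of \<open>p j (k - j)\<close>,
    from which the triangularity conditions \<open>high\<close>, \<open>deg\<close> and
    \<open>nz\<close> follow.\<close>
  have lead: "coeff (P k j) i = Polynomial.smult (coeff (q j) i) (p j (k - j))"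
    if "j \<le> k" "j \<le> i" for k j i
    by (rule koornwinder_poly_coeff_ge[OF inf P]) (use that qnz in auto)
  have high: "coeff (P k j) i = 0" if "j \<le> k" "j < i" for k j i
    using lead[of j k i] that qnz(1)[of j] by (simp add: coeff_eq_0)
  have deg: "degree (coeff (P k j) j) = k - j" if "j \<le> k" for k j
    using lead[of j k j] that qnz(2)[of j] pnz(1) by simp
  have nz: "coeff (P k j) j \<noteq> 0" if "j \<le> k" for k j
    using lead[of j k j] that qnz(2)[of j] pnz(2)[of j "k - j"] by auto
  define A' where "A' = mat (n + 1) (n + 2) (\<lambda>(i, j). if i = j then ttr_a (p i) (n - i) else 0)"
  define B' where "B' = mat (n + 1) (n + 1) (\<lambda>(i, j). if i = j then ttr_b (p i) (n - i) else 0)"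
  define C' where "C' = mat (n + 1) n
    (\<lambda>(i, j). if i = j then ttr_c (rho_times \<rho> (2 * i + 1) u) (p i) (n - i) else 0)"
  have carrier: "A' \<in> carrier_mat (n + 1) (n + 2)" "B' \<in> carrier_mat (n + 1) (n + 1)"
    "C' \<in> carrier_mat (n + 1) n"
    by (auto simp: A'_def B'_def C'_def)
  have "three_term_x P n A' B' C'"
    unfolding three_term_x_iff[OF carrier]
  proof (intro allI impI)
    fix i assume i: "i \<le> n"
    define a where "a = ttr_a (p i) (n - i)"
    define b where "b = ttr_b (p i) (n - i)"
    define c where "c = ttr_c (rho_times \<rho> (2 * i + 1) u) (p i) (n - i)"
    \<comment> \<open>In row \<open>i = n\<close> the univariate index \<open>n - i\<close> is zero:
      the univariate relation has no lower term, and \<open>C'\<close> has no diagonal entry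
      there.\<close>
    define G where "G = (if i < n then [:[:c:]:] * P (n - 1) i else 0)"
    have "koornwinder_poly \<rho> i (if i < n then [:c:] * p i (n - 1 - i) else 0) (q i) G"
    proof (cases "i < n")
      case True
      then show ?thesis using P[of i "n - 1"] by (simp add: G_def koornwinder_poly_mult del: mult_pCons_left)
    qed (simp add: G_def koornwinder_poly_def eval2_def)
    then have "koornwinder_poly \<rho> i
        ([:a:] * p i (n + 1 - i) + [:b:] * p i (n - i) + (if i < n then [:c:] * p i (n - 1 - i) else 0))
        (q i) ([:[:a:]:] * P (n + 1) i + [:[:b:]:] * P n i + G)"
      using i P[of i "n + 1"] P[of i n]
      by (intro koornwinder_poly_add koornwinder_poly_mult) auto
    \<comment> \<open>This is the relation for \<open>p i\<close> at index \<open>n - i\<close>; its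
      lower term is present exactly when \<open>i < n\<close>.\<close>
    also have "[:a:] * p i (n + 1 - i) + [:b:] * p i (n - i)
        + (if i < n then [:c:] * p i (n - 1 - i) else 0) = [:0, 1:] * p i (n - i)"
      using ortho_poly_seq_three_term[OF um p_ops, of i "n - i"] i
      by (simp add: a_def b_def c_def Suc_diff_le)
    \<comment> \<open>Both sides are built from the same univariate factor
      \<open>[:0, 1:] * p i (n - i)\<close>, so the uniqueness in
      \<open>koornwinder_poly_ex1\<close> identifies them.\<close>
    finally have "[:[:0, 1:]:] * P n i = [:[:a:]:] * P (n + 1) i + [:[:b:]:] * P n i + G"
      using koornwinder_poly_ex1[OF rho q_ops] koornwinder_poly_mult[OF P[OF i]] by blast
    moreover have "(\<Sum>j<n+2. [:[:A' $$ (i, j):]:] * P (n + 1) j) = [:[:a:]:] * P (n + 1) i"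
    proof -
      have "(\<Sum>j<n+2. [:[:A' $$ (i, j):]:] * P (n + 1) j)
          = (\<Sum>j<n+2. if i = j then [:[:a:]:] * P (n + 1) j else 0)"
        using i by (intro sum.cong) (auto simp: A'_def a_def)
      then show ?thesis using i by (simp del: sum.lessThan_Suc)
    qed
    moreover have "(\<Sum>j<n+1. [:[:B' $$ (i, j):]:] * P n j) = [:[:b:]:] * P n i"
    proof -
      have "(\<Sum>j<n+1. [:[:B' $$ (i, j):]:] * P n j)
          = (\<Sum>j<n+1. if i = j then [:[:b:]:] * P n j else 0)"
        using i by (intro sum.cong) (auto simp: B'_def b_def)
      then show ?thesis using i by (simp del: sum.lessThan_Suc)
    qed
    moreover have "(\<Sum>j<n. [:[:C' $$ (i, j):]:] * P (n - 1) j) = G"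
    proof -
      have "(\<Sum>j<n. [:[:C' $$ (i, j):]:] * P (n - 1) j)
          = (\<Sum>j<n. if i = j then [:[:c:]:] * P (n - 1) j else 0)"
        using i by (intro sum.cong) (auto simp: C'_def c_def)
      then show ?thesis by (simp add: G_def del: sum.lessThan_Suc)
    qed
    ultimately show "[:[:0, 1:]:] * P n i = (\<Sum>j<n+2. [:[:A' $$ (i, j):]:] * P (n + 1) j)
        + (\<Sum>j<n+1. [:[:B' $$ (i, j):]:] * P n j) + (\<Sum>j<n. [:[:C' $$ (i, j):]:] * P (n - 1) j)"
      by (simp only:)
  qed
  then have "three_term_x P n A B C \<longleftrightarrow> A = A' \<and> B = B' \<and> C = C'"
    using three_term_x_unique[OF A carrier(1) B carrier(2) C carrier(3) high deg nz] by blast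
  then show ?thesis unfolding A'_def B'_def C'_def .
qed

end
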